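(* Let $\mathcal{A}$ be a nonempty finite set of pairwise vertex-disjoint graphs, where each member of $\mathcal{A}$ is isomorphic to $A_k$ for some integer $k\ge 2$ (possibly different $k$ for different members). Let $G(\mathcal{A})$ be the complete join of all members of $\mathcal{A}$. Then $\gamma_L(G(\mathcal{A})) = \frac{|V(G(\mathcal{A}))|}{2}$.
   Context: Graphs are finite, simple and undirected. For a vertex $v$ of $G$, $N(v)$ denotes its open neighborhood. A dominating set of $G$ is a set $D\subseteq V(G)$ such that every vertex outside $D$ has a neighbor in $D$. A locating-dominating set of $G$ is a dominating set $D$ such that $N(u)\cap D\neq N(v)\cap D$ for every two distinct vertices $u,v\in V(G)\setminus D$. The location-domination number $\gamma_L(G)$ is the minimum cardinality of a locating-dominating set of $G$. For an integer $k\ge 2$, $A_k$ is the graph with vertex set $\{x_1,\ldots,x_{2k}\}$ in which two distinct vertices $x_i,x_j$ are adjacent if and only if $|i-j|\le k-1$. The complete join of a set $\{G_1,\ldots,G_m\}$ of pairwise vertex-disjoint graphs is the graph obtained from the disjoint union of $G_1,\ldots,G_m$ by adding all edges $uv$ with $u\in V(G_i)$ and $v\in V(G_j)$ for $1\le i<j\le m$ (for $m=1$ it is $G_1$ itself). *)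

theory Defs
  imports Complex_Main "Graph_Theory.Pair_Digraph" "Graph_Theory.Digraph_Isomorphism"
begin

text \<open>
  A finite simple undirected graph is a \<open>pair_graph\<close>: a finite, loop-free, symmetric
  digraph whose arcs are ordered pairs of vertices; an undirected edge \<open>uv\<close> is represented
  by the two arcs \<open>(u, v)\<close> and \<open>(v, u)\<close>.
\<close>

definition open_neighborhood :: "'a pair_pre_digraph \<Rightarrow> 'a \<Rightarrow> 'a set" where
  "open_neighborhood G v = {u. (v, u) \<in> parcs G}"

definition dominating_set :: "'a pair_pre_digraph \<Rightarrow> 'a set \<Rightarrow> bool" where
  "dominating_set G D \<longleftrightarrow>
     D \<subseteq> pverts G \<and> (\<forall>v \<in> pverts G - D. \<exists>u \<in> D. u \<in> open_neighborhood G v)"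

definition locating_dominating_set :: "'a pair_pre_digraph \<Rightarrow> 'a set \<Rightarrow> bool" where
  "locating_dominating_set G D \<longleftrightarrow>
     dominating_set G D \<and>
     (\<forall>u \<in> pverts G - D. \<forall>v \<in> pverts G - D. u \<noteq> v \<longrightarrow>
        open_neighborhood G u \<inter> D \<noteq> open_neighborhood G v \<inter> D)"

definition location_domination_number :: "'a pair_pre_digraph \<Rightarrow> nat" where
  "location_domination_number G =
     (LEAST n. \<exists>D. locating_dominating_set G D \<and> card D = n)"

definition graph_A :: "nat \<Rightarrow> nat pair_pre_digraph" where
  "graph_A k =
     \<lparr> pverts = {1..2 * k},
       parcs = {(i, j). i \<in> {1..2 * k} \<and> j \<in> {1..2 * k} \<and> i \<noteq> j \<and>
                  \<bar>int i - int j\<bar> \<le> int k - 1} \<rparr>"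

text \<open>
  The members of the set are meant to have pairwise disjoint vertex sets, so no renaming is
  needed to form their disjoint union.
\<close>

definition complete_join :: "'a pair_pre_digraph set \<Rightarrow> 'a pair_pre_digraph" where
  "complete_join \<G> =
     \<lparr> pverts = (\<Union>G \<in> \<G>. pverts G),
       parcs = (\<Union>G \<in> \<G>. parcs G) \<union>
         {(u, v). \<exists>G \<in> \<G>. \<exists>H \<in> \<G>. G \<noteq> H \<and> u \<in> pverts G \<and> v \<in> pverts H} \<rparr>"

lemma pair_graph_graph_A: "pair_graph (graph_A k)"
proof -
  have "finite (parcs (graph_A k))"
    by (rule finite_subset[of _ "{1..2 * k} \<times> {1..2 * k}"]) (auto simp: graph_A_def)
  then show ?thesis
    by unfold_locales (auto simp: graph_A_def symmetric_def sym_def abs_minus_commute)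
qed

lemma pair_graph_complete_join:
  assumes fin: "finite \<G>"
    and gr: "\<And>G. G \<in> \<G> \<Longrightarrow> pair_graph G"
    and disj: "pairwise (\<lambda>G H. disjnt (pverts G) (pverts H)) \<G>"
  shows "pair_graph (complete_join \<G>)"
proof -
  have wf: "u \<in> pverts G" "v \<in> pverts G" "u \<noteq> v" "(v, u) \<in> parcs G"
    if "G \<in> \<G>" "(u, v) \<in> parcs G" for G u v
  proof -
    interpret pair_graph G by (rule gr) fact
    show "u \<in> pverts G" "v \<in> pverts G" using that(2) by (auto dest: wellformed')
    show "u \<noteq> v" using that(2) by (auto dest: no_loops')
    show "(v, u) \<in> parcs G" using that(2) pair_sym_arcs by (auto simp: symmetric_def sym_def)
  qed
  have finV: "finite (pverts (complete_join \<G>))"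
    using fin gr by (auto simp: complete_join_def
        intro!: pair_fin_digraph.pair_finite_verts pair_digraph.axioms(1) pair_graph.axioms(1))
  have sub: "parcs (complete_join \<G>) \<subseteq> pverts (complete_join \<G>) \<times> pverts (complete_join \<G>)"
    using wf(1,2) by (fastforce simp: complete_join_def)
  have ne: "u \<noteq> v" if "(u, v) \<in> parcs (complete_join \<G>)" for u v
    using that wf(3) disj by (fastforce simp: complete_join_def pairwise_def disjnt_def)
  have sy: "(v, u) \<in> parcs (complete_join \<G>)" if "(u, v) \<in> parcs (complete_join \<G>)" for u v
    using that wf(4) by (fastforce simp: complete_join_def)
  show ?thesis
  proof unfold_locales
    show "finite (parcs (complete_join \<G>))"
      using finV sub by (meson finite_SigmaI finite_subset)
    show "symmetric (with_proj (complete_join \<G>))"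
      using sy by (auto simp: symmetric_def sym_def)
  qed (use finV sub ne in auto)
qed

lemma location_domination_number_attained:
  "\<exists>D. locating_dominating_set G D \<and> card D = location_domination_number G"
proof -
  have "locating_dominating_set G (pverts G)"
    by (auto simp: locating_dominating_set_def dominating_set_def)
  then have "\<exists>n D. locating_dominating_set G D \<and> card D = n" by blast
  then show ?thesis
    unfolding location_domination_number_def by (rule LeastI_ex)
qed

lemma digraph_iso_with_projD:
  assumes "digraph_iso (with_proj G) (with_proj H)"
  shows "\<exists>f. bij_betw f (pverts G) (pverts H) \<and>
    (\<forall>u \<in> pverts G. \<forall>v \<in> pverts G. (u, v) \<in> parcs G \<longleftrightarrow> (f u, f v) \<in> parcs H)"
proof -
  from assms obtain h where h: "pre_digraph.digraph_isomorphism (with_proj G) h"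
    and H: "with_proj H = app_iso h (with_proj G)"
    unfolding digraph_iso_def by blast
  let ?f = "iso_verts h"
  have V: "pverts H = ?f ` pverts G" and A: "parcs H = iso_arcs h ` parcs G"
    and T: "iso_tail h = fst" "iso_head h = snd"
    using H by (auto simp: with_proj_def app_iso_def)
  have wf: "pair_wf_digraph G" and inj: "inj_on ?f (pverts G)"
    and arc: "\<And>a. a \<in> parcs G \<Longrightarrow> iso_arcs h a = (?f (fst a), ?f (snd a))"
    using h T by (auto simp: pre_digraph.digraph_isomorphism_def wf_digraph_wp_iff prod_eq_iff)
  have PH: "parcs H = (\<lambda>(u, v). (?f u, ?f v)) ` parcs G"
    unfolding A by (rule image_cong) (auto simp: arc)
  have "(u, v) \<in> parcs G \<longleftrightarrow> (?f u, ?f v) \<in> parcs H"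
    if uv: "u \<in> pverts G" "v \<in> pverts G" for u v
  proof
    assume "(?f u, ?f v) \<in> parcs H"
    then obtain a b where ab: "(a, b) \<in> parcs G" "?f a = ?f u" "?f b = ?f v"
      unfolding PH by auto
    moreover have "a \<in> pverts G" "b \<in> pverts G"
      using ab(1) pair_wf_digraph.wellformed'[OF wf] by auto
    ultimately show "(u, v) \<in> parcs G"
      using inj uv by (metis inj_onD)
  qed (force simp: PH)
  then show ?thesis using V inj by (auto simp: bij_betw_def)
qed

end

theory Submission
  imports Defs
begin

text \<open>
  In the complement, \<open>A\<^sub>k\<close> becomes a half graph: the non-neighbours of \<open>x\<^sub>i\<close> are the final segment
  \<open>x\<^bsub>i+k\<^esub>, \<dots>, x\<^bsub>2k\<^esub>\<close> if \<open>i \<le> k\<close> and the initial segment \<open>x\<^sub>1, \<dots>, x\<^bsub>i-k\<^esub>\<close> otherwise.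
  A vertex outside a locating-dominating set \<open>D\<close> is determined by its non-neighbours in \<open>D\<close>, and if
  there are any then it is determined by the one with index closest to its own.
  Hence in each member at most as many vertices outside \<open>D\<close> have a non-neighbour in \<open>D\<close> as
  there are elements of \<open>D\<close>, and in the whole join at most one vertex has no non-neighbour in \<open>D\<close>.
  So \<open>n \<le> 2 |D| + 1\<close>, and \<open>n\<close> is even. Conversely, \<open>{x\<^sub>2, \<dots>, x\<^bsub>k+1\<^esub>}\<close> is
  locating-dominating in \<open>A\<^sub>k\<close> and none of its outside vertices is adjacent to all of it, so
  the union of these sets over all members is locating-dominating in the join.
\<close>

section \<open>Index labellings of copies of \<open>graph_A k\<close>\<close>

text \<open>An index labelling moves every adjacency question to natural numbers. The distance bound
  appears as two strict inequalities, which avoids integers and truncated subtraction.\<close>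

definition A_labelling :: "nat \<Rightarrow> (nat \<Rightarrow> 'a) \<Rightarrow> 'a pair_pre_digraph \<Rightarrow> bool" where
  "A_labelling k f G \<longleftrightarrow> bij_betw f {1..2 * k} (pverts G) \<and>
     (\<forall>i \<in> {1..2 * k}. \<forall>j \<in> {1..2 * k}.
        f j \<in> open_neighborhood G (f i) \<longleftrightarrow> i \<noteq> j \<and> i < j + k \<and> j < i + k)"

lemma A_labelling_exists:
  assumes "digraph_iso (with_proj (graph_A k)) (with_proj G)"
  shows "\<exists>f. A_labelling k f G"
  using digraph_iso_with_projD[OF assms]
  by (fastforce simp: A_labelling_def graph_A_def open_neighborhood_def)

lemma A_labelling_card: "A_labelling k f G \<Longrightarrow> card (pverts G) = 2 * k"
  using bij_betw_same_card[of f "{1..2 * k}" "pverts G"] by (simp add: A_labelling_def)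

section \<open>Locating sets inside a single member\<close>

text \<open>\<open>T i\<close> is the set of non-neighbours of \<open>x_i\<close> with index in
  \<open>S\<close>. Sending \<open>i\<close> to the element of \<open>T i\<close> closest to it is
  injective: this element reveals the half containing \<open>i\<close>, and then cuts
  \<open>T i\<close> out of \<open>S\<close> as a segment.\<close>

lemma card_outside_le_nat:
  fixes k :: nat and S :: "nat set"
  defines "T \<equiv> \<lambda>i. {d \<in> S. d + k \<le> i \<or> i + k \<le> d}"
  assumes S: "S \<subseteq> {1..2 * k}"
    and inj: "inj_on T ({1..2 * k} - S)"
  shows "card {i \<in> {1..2 * k} - S. T i \<noteq> {}} \<le> card S"
proof -
  have finS: "finite S" using S finite_subset by blast
  \<comment> \<open>For \<open>i <= k\<close> all of \<open>T i\<close> lies above \<open>i\<close>,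
    otherwise all of it lies below, so \<open>g i\<close> is the closest element in both
    cases.\<close>
  define g where "g i = (if i \<le> k then Min (T i) else Max (T i))" for i
  have finT: "finite (T i)" for i using finS by (simp add: T_def)
  have g_in: "g i \<in> T i" if "T i \<noteq> {}" for i
    using that finT by (simp add: g_def)
  have low: "T i = {d \<in> S. g i \<le> d}" if i: "i \<in> {1..k}" "T i \<noteq> {}" for i
  proof -
    have "g i \<le> d" if "d \<in> T i" for d using that i finT by (simp add: g_def)
    moreover have "i + k \<le> g i" using g_in[OF i(2)] i S by (auto simp: T_def)
    ultimately show ?thesis by (auto simp: T_def)
  qed
  have high: "T i = {d \<in> S. d \<le> g i}" if i: "i \<in> {k<..2 * k}" "T i \<noteq> {}" for i
  proof -
    have "d \<le> g i" if "d \<in> T i" for d using that i finT by (simp add: g_def)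
    moreover have "g i + k \<le> i" using g_in[OF i(2)] i S by (auto simp: T_def)
    ultimately show ?thesis by (auto simp: T_def)
  qed
  \<comment> \<open>Non-neighbours lie in opposite halves, so equal values of \<open>g\<close> never
    mix an upper segment with a lower one.\<close>
  have side: "g i > k \<longleftrightarrow> i \<le> k" if "i \<in> {1..2 * k}" "T i \<noteq> {}" for i
    using g_in[OF that(2)] that S by (auto simp: T_def)
  have "inj_on g {i \<in> {1..2 * k} - S. T i \<noteq> {}}"
  proof (rule inj_onI)
    fix i j
    assume ij: "i \<in> {i \<in> {1..2 * k} - S. T i \<noteq> {}}" "j \<in> {i \<in> {1..2 * k} - S. T i \<noteq> {}}"
      and eq: "g i = g j"
    then have "i \<le> k \<longleftrightarrow> j \<le> k" using side[of i] side[of j] by auto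
    then have "T i = T j"
      using ij eq low[of i] low[of j] high[of i] high[of j] by (cases "i \<le> k") auto
    then show "i = j" using inj ij by (auto dest: inj_onD)
  qed
  moreover have "g ` {i \<in> {1..2 * k} - S. T i \<noteq> {}} \<subseteq> S"
    using g_in by (auto simp: T_def)
  ultimately show ?thesis using card_inj_on_le finS by blast
qed

text \<open>The index bound is pulled back along \<open>f\<close>. Separation is phrased by
  non-neighbours in \<open>D\<close> because in the join these all lie in the vertex's own
  member.\<close>

lemma A_labelling_card_outside_le:
  assumes lab: "A_labelling k f G"
    and D: "D \<subseteq> pverts G"
    and inj: "inj_on (\<lambda>v. D - open_neighborhood G v) (pverts G - D)"
  shows "card {v \<in> pverts G - D. \<not> D \<subseteq> open_neighborhood G v} \<le> card D"
proof -
  define S where "S = {i \<in> {1..2 * k}. f i \<in> D}"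
  define T where "T i = {d \<in> S. d + k \<le> i \<or> i + k \<le> d}" for i
  have injf: "inj_on f {1..2 * k}" and V: "f ` {1..2 * k} = pverts G"
    using lab by (auto simp: A_labelling_def bij_betw_def)
  have "f ` S = f ` {1..2 * k} \<inter> D" by (auto simp: S_def)
  then have fS: "f ` S = D" using V D by simp blast
  have injS: "inj_on f S" using injf by (rule inj_on_subset) (auto simp: S_def)
  have T: "D - open_neighborhood G (f i) = f ` T i" if "i \<in> {1..2 * k} - S" for i
  proof -
    have "f d \<in> open_neighborhood G (f i) \<longleftrightarrow> d \<notin> T i" if "d \<in> S" for d
      using lab that \<open>i \<in> {1..2 * k} - S\<close> by (auto simp: A_labelling_def S_def T_def)
    moreover have "T i \<subseteq> S" by (auto simp: T_def)
    ultimately show ?thesis unfolding fS[symmetric] by auto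
  qed
  have "inj_on T ({1..2 * k} - S)"
  proof (rule inj_onI)
    fix i j assume ij: "i \<in> {1..2 * k} - S" "j \<in> {1..2 * k} - S" "T i = T j"
    then have "f i = f j"
      using V T[of i] T[of j] by (intro inj_onD[OF inj]) (auto simp: S_def)
    then show "i = j" using ij injf by (auto dest: inj_onD)
  qed
  then have le: "card {i \<in> {1..2 * k} - S. T i \<noteq> {}} \<le> card S"
    unfolding T_def by (intro card_outside_le_nat) (auto simp: S_def)
  have "{v \<in> pverts G - D. \<not> D \<subseteq> open_neighborhood G v}
      \<subseteq> f ` {i \<in> {1..2 * k} - S. T i \<noteq> {}}"
  proof
    fix v assume v: "v \<in> {v \<in> pverts G - D. \<not> D \<subseteq> open_neighborhood G v}"
    then obtain i where "v = f i" "i \<in> {1..2 * k}" using V by blast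
    then show "v \<in> f ` {i \<in> {1..2 * k} - S. T i \<noteq> {}}"
      using v T[of i] by (auto simp: S_def)
  qed
  then have "card {v \<in> pverts G - D. \<not> D \<subseteq> open_neighborhood G v}
      \<le> card {i \<in> {1..2 * k} - S. T i \<noteq> {}}"
    by (intro surj_card_le) auto
  also note le
  also have "card S = card D" using card_image[OF injS] fS by simp
  finally show ?thesis .
qed

text \<open>The last two clauses serve the join: a missed element separates a vertex from those of
  other members, and a met element gives domination even when there is only one member.\<close>

lemma A_labelling_half:
  assumes lab: "A_labelling k f G" and k: "k \<ge> 2"
  shows "\<exists>D \<subseteq> pverts G. card D = k \<and>
    inj_on (\<lambda>v. D - open_neighborhood G v) (pverts G - D) \<and>
    (\<forall>v \<in> pverts G - D. D - open_neighborhood G v \<noteq> {} \<and> D \<inter> open_neighborhood G v \<noteq> {})"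
proof -
  define S where "S = {2..k + 1}"
  have sub: "S \<subseteq> {1..2 * k}" using k by (auto simp: S_def)
  have injf: "inj_on f {1..2 * k}" and V: "f ` {1..2 * k} = pverts G"
    using lab by (auto simp: A_labelling_def bij_betw_def)
  have VD: "pverts G - f ` S = f ` ({1..2 * k} - S)"
    using inj_on_image_set_diff[OF injf _ sub] V by auto
  have nb: "f d \<in> open_neighborhood G (f i) \<longleftrightarrow> i < d + k \<and> d < i + k"
    if "d \<in> S" "i \<in> {1..2 * k} - S" for d i
    using lab that sub by (auto simp: A_labelling_def)
  have outside: "i = 1 \<or> i \<in> {k + 2..2 * k}" if "i \<in> {1..2 * k} - S" for i
    using that by (auto simp: S_def)
  \<comment> \<open>A non-neighbour of \<open>i\<close> in \<open>S\<close> at index distance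
    exactly \<open>k\<close>, the least distance possible.\<close>
  define d where "d i = (if i = 1 then k + 1 else i - k)" for i
  have d: "d i \<in> S \<and> f (d i) \<notin> open_neighborhood G (f i)" if "i \<in> {1..2 * k} - S" for i
  proof -
    have "d i \<in> S" using outside[OF that] k by (auto simp: d_def S_def)
    then show ?thesis using nb[of "d i" i] that outside[OF that] by (auto simp: d_def)
  qed
  \<comment> \<open>Since \<open>i < j\<close> rules out \<open>j = 1\<close>, here
    \<open>d j = j - k\<close>. It is adjacent to each smaller outside index but not to
    \<open>j\<close>, so it tells the two apart.\<close>
  have sep: "f (d j) \<in> open_neighborhood G (f i)"
    if "i \<in> {1..2 * k} - S" "j \<in> {1..2 * k} - S" "i < j" for i j
    using nb[of "d j" i] d[of j] that outside[of i] outside[of j] by (auto simp: d_def)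
  have "inj_on (\<lambda>v. f ` S - open_neighborhood G v) (pverts G - f ` S)"
  proof (rule inj_onI)
    fix u v assume uv: "u \<in> pverts G - f ` S" "v \<in> pverts G - f ` S"
      and eq: "f ` S - open_neighborhood G u = f ` S - open_neighborhood G v"
    obtain i j where ij: "u = f i" "v = f j" "i \<in> {1..2 * k} - S" "j \<in> {1..2 * k} - S"
      using uv unfolding VD by auto
    then have "\<not> i < j" "\<not> j < i" using sep d eq by blast+
    then show "u = v" using ij by simp
  qed
  moreover have "f ` S - open_neighborhood G v \<noteq> {} \<and> f ` S \<inter> open_neighborhood G v \<noteq> {}"
    if v: "v \<in> pverts G - f ` S" for v
  proof -
    obtain i where i: "v = f i" "i \<in> {1..2 * k} - S" using v unfolding VD by auto
    \<comment> \<open>A neighbour of \<open>i\<close> in \<open>S\<close>; that 2 is adjacent to 1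
      relies on \<open>k >= 2\<close>.\<close>
    define e where "e = (if i = 1 then 2 else k + 1)"
    have "e \<in> S" using k by (auto simp: e_def S_def)
    then have "f e \<in> f ` S \<inter> open_neighborhood G v"
      using nb[of e i] i outside[of i] k by (auto simp: e_def)
    then show ?thesis using d[of i] i by blast
  qed
  moreover have "card (f ` S) = k"
    using card_image[OF inj_on_subset[OF injf sub]] by (simp add: S_def)
  moreover have "f ` S \<subseteq> pverts G" using V sub by auto
  ultimately show ?thesis by blast
qed

section \<open>Neighbourhoods in the join and the two bounds\<close>

text \<open>Arcs of another member stay inside that member, and added arcs have their ends in
  different members, so by disjointness neither kind has both ends in \<open>G\<close>.\<close>

lemma complete_join_neighborhood_same:
  assumes "\<forall>G \<in> \<G>. pair_graph G"
    and "pairwise (\<lambda>G H. disjnt (pverts G) (pverts H)) \<G>"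
    and "G \<in> \<G>" "u \<in> pverts G" "v \<in> pverts G"
  shows "v \<in> open_neighborhood (complete_join \<G>) u \<longleftrightarrow> v \<in> open_neighborhood G u"
proof -
  have eq: "H = G" if "H \<in> \<G>" "u \<in> pverts H \<or> v \<in> pverts H" for H
    using that assms by (auto simp: pairwise_def disjnt_def)
  have "u \<in> pverts H" if "H \<in> \<G>" "(u, v) \<in> parcs H" for H
  proof -
    interpret pair_graph H using assms(1) that(1) by blast
    show ?thesis using that(2) by (auto dest: wellformed')
  qed
  then have "(\<exists>H \<in> \<G>. (u, v) \<in> parcs H) \<longleftrightarrow> (u, v) \<in> parcs G"
    using assms(3) eq by blast
  moreover have "\<not> (\<exists>H \<in> \<G>. \<exists>H' \<in> \<G>. H \<noteq> H' \<and> u \<in> pverts H \<and> v \<in> pverts H')"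
    using eq by blast
  ultimately show ?thesis unfolding open_neighborhood_def complete_join_def by simp blast
qed

lemma complete_join_neighborhood_other:
  assumes "G \<in> \<G>" "H \<in> \<G>" "G \<noteq> H" "u \<in> pverts G" "v \<in> pverts H"
  shows "v \<in> open_neighborhood (complete_join \<G>) u"
  using assms by (auto simp: open_neighborhood_def complete_join_def)

lemma pverts_complete_join: "pverts (complete_join \<G>) = (\<Union>G \<in> \<G>. pverts G)"
  by (simp add: complete_join_def)

theorem theorem8:
  fixes \<A> :: "'a pair_pre_digraph set"
  assumes "finite \<A>" and "\<A> \<noteq> {}"
    and "\<And>G. G \<in> \<A> \<Longrightarrow> pair_graph G"
    and "pairwise (\<lambda>G H. disjnt (pverts G) (pverts H)) \<A>"
    and "\<And>G. G \<in> \<A> \<Longrightarrow> \<exists>k \<ge> 2. digraph_iso (with_proj (graph_A k)) (with_proj G)"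
  shows "real (location_domination_number (complete_join \<A>)) =
         real (card (pverts (complete_join \<A>))) / 2"
proof -
  let ?J = "complete_join \<A>"
  let ?N = "open_neighborhood ?J"
  have "\<forall>G \<in> \<A>. pair_graph G" using assms(3) by blast
  note same = complete_join_neighborhood_same[OF this assms(4)]
  note other = complete_join_neighborhood_other[where \<G> = \<A>]
  have "\<exists>k f. k \<ge> 2 \<and> A_labelling k f G" if "G \<in> \<A>" for G
    using assms(5)[OF that] A_labelling_exists by blast
  then obtain K F where K: "\<And>G. G \<in> \<A> \<Longrightarrow> K G \<ge> 2"
    and F: "\<And>G. G \<in> \<A> \<Longrightarrow> A_labelling (K G) (F G) G"
    by metis
  have finV: "finite (pverts G)" if "G \<in> \<A>" for G
    using A_labelling_card[OF F[OF that]] K[OF that] by (intro card_ge_0_finite) simp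
  have disj: "pverts G \<inter> pverts H = {}" if "G \<in> \<A>" "H \<in> \<A>" "G \<noteq> H" for G H
    using assms(4) that by (auto simp: pairwise_def disjnt_def)
  have V: "pverts ?J = (\<Union>G \<in> \<A>. pverts G)" by (rule pverts_complete_join)
  have finJ: "finite (pverts ?J)" using V finV assms(1) by simp
  have card_split: "card (\<Union>G \<in> \<A>. B G) = (\<Sum>G \<in> \<A>. card (B G))"
    if "\<And>G. G \<in> \<A> \<Longrightarrow> B G \<subseteq> pverts G" for B :: "'a pair_pre_digraph \<Rightarrow> 'a set"
  proof (rule card_UN_disjoint[OF assms(1)])
    show "\<forall>G\<in>\<A>. finite (B G)" using that finV finite_subset by blast
    show "\<forall>G\<in>\<A>. \<forall>H\<in>\<A>. G \<noteq> H \<longrightarrow> B G \<inter> B H = {}" using that disj by blast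
  qed
  have cardV: "card (pverts ?J) = 2 * (\<Sum>G \<in> \<A>. K G)"
    using card_split[of pverts] A_labelling_card[OF F] by (simp add: V sum_distrib_left)

  have lower: "(\<Sum>G \<in> \<A>. K G) \<le> card D" if LD: "locating_dominating_set ?J D" for D
  proof -
    have DV: "D \<subseteq> pverts ?J" and
      sep: "\<And>u v. u \<in> pverts ?J - D \<Longrightarrow> v \<in> pverts ?J - D \<Longrightarrow> ?N u \<inter> D = ?N v \<inter> D \<Longrightarrow> u = v"
      using LD by (auto simp: locating_dominating_set_def dominating_set_def)
    have finD: "finite D" using DV finJ finite_subset by blast
    let ?B = "\<lambda>G. {v \<in> pverts G - D \<inter> pverts G. \<not> D \<inter> pverts G \<subseteq> open_neighborhood G v}"
    let ?W = "{v \<in> pverts ?J - D. D \<subseteq> ?N v}"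
    \<comment> \<open>Elements of \<open>D\<close> in other members are always neighbours, so only
      the part of \<open>D\<close> in the own member can distinguish two vertices of
      \<open>G\<close>.\<close>
    have trace: "v \<in> ?N u \<longleftrightarrow> (v \<in> pverts G \<longrightarrow> v \<in> open_neighborhood G u)"
      if "G \<in> \<A>" "u \<in> pverts G" "v \<in> D" for G u v
      using that same[of G u v] other[of G _ u v] DV V by (cases "v \<in> pverts G") auto
    have "card (?B G) \<le> card (D \<inter> pverts G)" if G: "G \<in> \<A>" for G
    proof (rule A_labelling_card_outside_le[OF F[OF G]])
      show "inj_on (\<lambda>v. D \<inter> pverts G - open_neighborhood G v) (pverts G - D \<inter> pverts G)"
      proof (rule inj_onI)
        fix u v assume uv: "u \<in> pverts G - D \<inter> pverts G" "v \<in> pverts G - D \<inter> pverts G"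
          and eq: "D \<inter> pverts G - open_neighborhood G u = D \<inter> pverts G - open_neighborhood G v"
        have "?N u \<inter> D = ?N v \<inter> D"
          using uv eq trace[OF G, of u] trace[OF G, of v] by blast
        then show "u = v" using uv G V by (intro sep) auto
      qed
    qed simp
    then have "(\<Sum>G \<in> \<A>. card (?B G)) \<le> (\<Sum>G \<in> \<A>. card (D \<inter> pverts G))"
      by (rule sum_mono)
    then have "card (\<Union>G \<in> \<A>. ?B G) \<le> card (\<Union>G \<in> \<A>. D \<inter> pverts G)"
      using card_split[of ?B] card_split[of "\<lambda>G. D \<inter> pverts G"] by simp
    also have "(\<Union>G \<in> \<A>. D \<inter> pverts G) = D" using DV V by auto
    finally have B: "card (\<Union>G \<in> \<A>. ?B G) \<le> card D" .
    \<comment> \<open>All vertices of \<open>?W\<close> have the same trace, namely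
      \<open>D\<close>.\<close>
    have "\<forall>u \<in> ?W. \<forall>v \<in> ?W. u = v" using sep by blast
    then have W: "card ?W \<le> 1"
      using finJ by (simp add: card_le_Suc0_iff_eq)
    have "pverts ?J \<subseteq> D \<union> ?W \<union> (\<Union>G \<in> \<A>. ?B G)"
    proof
      fix v assume v: "v \<in> pverts ?J"
      then obtain G where "G \<in> \<A>" "v \<in> pverts G" using V by auto
      then show "v \<in> D \<union> ?W \<union> (\<Union>G \<in> \<A>. ?B G)" using v trace[of G v] by blast
    qed
    then have "card (pverts ?J) \<le> card (D \<union> ?W \<union> (\<Union>G \<in> \<A>. ?B G))"
      using finD finJ finV assms(1) by (intro card_mono) auto
    also have "\<dots> \<le> card D + card ?W + card (\<Union>G \<in> \<A>. ?B G)"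
      by (meson card_Un_le add_le_mono order_refl order_trans)
    \<comment> \<open>Twice the sum is at most \<open>2 * card D + 1\<close>; integrality removes
      the extra 1.\<close>
    finally show ?thesis using B W cardV by linarith
  qed

  have "\<exists>D. locating_dominating_set ?J D \<and> card D = (\<Sum>G \<in> \<A>. K G)"
  proof -
    define P where "P G D \<longleftrightarrow> D \<subseteq> pverts G \<and> card D = K G \<and>
      inj_on (\<lambda>v. D - open_neighborhood G v) (pverts G - D) \<and>
      (\<forall>v \<in> pverts G - D. D - open_neighborhood G v \<noteq> {} \<and> D \<inter> open_neighborhood G v \<noteq> {})"
      for G D
    have "\<exists>D. P G D" if "G \<in> \<A>" for G
      unfolding P_def using A_labelling_half[OF F[OF that] K[OF that]] .
    then obtain E where PE: "\<And>G. G \<in> \<A> \<Longrightarrow> P G (E G)"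
      by metis
    have E: "E G \<subseteq> pverts G" and cardE: "card (E G) = K G"
      and injE: "inj_on (\<lambda>v. E G - open_neighborhood G v) (pverts G - E G)" if "G \<in> \<A>" for G
      using PE[OF that] by (simp_all add: P_def)
    have missE: "E G - open_neighborhood G v \<noteq> {}" and meetE: "E G \<inter> open_neighborhood G v \<noteq> {}"
      if "G \<in> \<A>" "v \<in> pverts G - E G" for G v
      using PE[OF that(1)] that(2) by (simp_all add: P_def)
    let ?D = "\<Union>G \<in> \<A>. E G"
    have sameE: "E G \<inter> ?N v = E G \<inter> open_neighborhood G v" if "G \<in> \<A>" "v \<in> pverts G" for G v
      using same[OF that] E that by blast
    have "dominating_set ?J ?D"
      unfolding dominating_set_def
    proof (intro conjI ballI)
      show "?D \<subseteq> pverts ?J" using E V by auto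
      fix v assume "v \<in> pverts ?J - ?D"
      then obtain G where G: "G \<in> \<A>" "v \<in> pverts G - E G" using V by auto
      then show "\<exists>u \<in> ?D. u \<in> ?N v" using sameE[of G v] meetE[OF G] by blast
    qed
    moreover have "u = v" if u: "u \<in> pverts ?J - ?D" and v: "v \<in> pverts ?J - ?D"
      and eq: "?N u \<inter> ?D = ?N v \<inter> ?D" for u v
    proof -
      obtain G H where G: "G \<in> \<A>" "u \<in> pverts G - E G" and H: "H \<in> \<A>" "v \<in> pverts H - E H"
        using u v V by auto
      have eqG: "E G \<inter> ?N u = E G \<inter> ?N v" using eq G by blast
      show "u = v"
      proof (cases "G = H")
        case True
        then have "E G - open_neighborhood G u = E G - open_neighborhood G v"
          using eqG sameE[of G u] sameE[of G v] G H by blast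
        then show ?thesis using injE[OF G(1)] G H True by (auto dest: inj_onD)
      next
        case False
        \<comment> \<open>In different members, \<open>v\<close> sees all of \<open>E G\<close>,
          while \<open>u\<close> misses some element of it.\<close>
        then have "E G \<subseteq> ?N v" using other[of H G v] G H E by blast
        then show ?thesis using eqG sameE[of G u] missE[OF G] G by blast
      qed
    qed
    moreover have "card ?D = (\<Sum>G \<in> \<A>. K G)" using card_split[of E] E cardE by simp
    ultimately show ?thesis
      unfolding locating_dominating_set_def by (intro exI[of _ ?D]) auto
  qed
  then have "location_domination_number ?J = (\<Sum>G \<in> \<A>. K G)"
    unfolding location_domination_number_def using lower by (intro Least_equality) auto
  then show ?thesis using cardV by simp
qed

end
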